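(* There exists exactly one function $F:]-1,\infty[\to]0,\infty[$ with the properties (i) $F(0)=1$; (ii) $F$ is log-convex; (iii) $1/F(s)=1/F(s+1)-F(s+1)$ for all $s>-1$; namely $F(s)=\int_0^1 t^s\,d\mu(t)$ for $s>-1$ (this integral being finite for $s>-1$).
   Context: Let $(m_n)_{n\ge0}$ be the unique sequence of positive reals with $m_0=1$ and $(1+m_1+\cdots+m_n)\,m_n=1$ for $n\ge1$. It is a Hausdorff moment sequence: let $\mu$ be the unique probability measure on $[0,1]$ with $\int_0^1 t^n\,d\mu(t)=m_n$ for all $n\ge0$; it has no mass at $0$. *)

theory Defs
  imports "HOL-Probability.Probability"
begin

text \<open>The sequence (m_n): the unique sequence of positive reals with m_0 = 1 and
  (1 + m_1 + ... + m_n) m_n = 1 for n >= 1. Since m_0 = 1, the factor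
  1 + m_1 + ... + m_n equals the sum of m_k for k <= n.\<close>
definition mseq :: "nat \<Rightarrow> real" where
  "mseq = (THE m. m 0 = 1 \<and> (\<forall>n. m n > 0) \<and>
                  (\<forall>n\<ge>1. (\<Sum>k\<le>n. m k) * m n = 1))"

definition good_F :: "(real \<Rightarrow> real) \<Rightarrow> bool" where
  "good_F F \<longleftrightarrow>
     (\<forall>s>-1. F s > 0) \<and>
     F 0 = 1 \<and>
     convex_on {-1<..} (\<lambda>s. ln (F s)) \<and>
     (\<forall>s>-1. 1 / F s = 1 / F (s + 1) - F (s + 1))"

end

theory Submission
  imports Defs
begin

text \<open>
  Write \<open>m\<close> for the sequence and \<open>F\<close> for the Mellin transform of \<open>\<mu>\<close>. Multiplied out, the functional
  equation reads \<open>F(s) = F(s+1) + F(s) F(s+1)\<^sup>2\<close>, which is the identity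
  \<open>\<integral> f(t) = \<integral> t f(t) + \<integral>\<integral>\<integral> u v f(t u v)\<close> for \<open>f(t) = t\<^sup>s\<close>. For monomials this identity
  is the recursion of \<open>m\<close>, so by the Weierstrass approximation theorem it holds for all continuous \<open>f\<close>
  on \<open>[0,1]\<close>, in particular for \<open>t\<^sup>s\<close> with \<open>s > 0\<close>. For \<open>-1 < s \<le> 0\<close>, applying it to continuous
  truncations \<open>f\<^sub>n \<le> t\<^sup>s\<close> that satisfy \<open>f\<^sub>n(t c) \<le> c\<^sup>s f\<^sub>n(t)\<close> bounds \<open>\<integral> f\<^sub>n\<close> by
  \<open>F(s+1) / (1 - F(s+1)\<^sup>2)\<close>, which gives integrability and then the identity in the limit. The case
  \<open>s = 0\<close> shows \<open>F(0) = 1\<close>, that is, \<open>\<mu>\<close> has no mass at \<open>0\<close>.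

  For uniqueness, two solutions \<open>F\<close> and \<open>G\<close> agree with \<open>m\<close> at the integers. For \<open>0 \<le> s \<le> 1\<close> the quantity
  \<open>\<bar>1/F(n+s) - 1/G(n+s)\<bar> / m\<^sub>n\<close> is nondecreasing in \<open>n\<close> by the functional equation, and it tends to \<open>0\<close>
  because log-convexity pins both values between powers of ratios of consecutive \<open>m\<^sub>n\<close>.
\<close>

section \<open>The sequence\<close>

text \<open>These are the reciprocals of the sequence. From the value y the next one is the positive
  root z of z^2 = y z + 1, that is, z - 1/z = y.\<close>

primrec inv_mseq :: "nat \<Rightarrow> real" where
  "inv_mseq 0 = 1"
| "inv_mseq (Suc n) = (inv_mseq n + sqrt ((inv_mseq n)\<^sup>2 + 4)) / 2"

lemma inv_mseq_pos: "inv_mseq n > 0"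
proof (induction n)
  case (Suc n)
  have "sqrt ((inv_mseq n)\<^sup>2 + 4) > 0" by (simp add: add_nonneg_pos)
  with Suc show ?case by (simp add: add_pos_pos del: real_sqrt_gt_0_iff)
qed simp

lemma inv_mseq_step: "inv_mseq (Suc n) = inv_mseq n + 1 / inv_mseq (Suc n)"
proof -
  let ?y = "inv_mseq n" and ?z = "inv_mseq (Suc n)"
  have "2 * ?z - ?y = sqrt (?y\<^sup>2 + 4)" by (simp add: field_simps)
  hence "(2 * ?z - ?y)\<^sup>2 = ?y\<^sup>2 + 4" by (metis add_nonneg_nonneg real_sqrt_pow2 zero_le_numeral zero_le_power2)
  hence "?z * ?z = ?y * ?z + 1" by (simp only: power2_eq_square) algebra
  hence "?z * (?z - ?y) = 1" by (simp only: right_diff_distrib mult.commute[of ?z ?y])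
  moreover have "?z \<noteq> 0" using inv_mseq_pos[of "Suc n"] by linarith
  ultimately have "?z - ?y = 1 / ?z" by (simp add: nonzero_eq_divide_eq mult.commute)
  thus ?thesis by linarith
qed

declare inv_mseq.simps(2) [simp del]

text \<open>The map x -> 1/x - x is strictly decreasing on the positive reals. Its injectivity lets
  the functional equation determine F(s+1) from F(s).\<close>

lemma recip_diff_le_imp_ge:
  fixes x y :: real
  assumes "0 < x" "0 < y" "1 / x - x \<le> 1 / y - y"
  shows "y \<le> x"
proof (rule ccontr)
  assume "\<not> y \<le> x"
  hence "1 / y < 1 / x" using assms by (intro divide_strict_left_mono) auto
  thus False using assms \<open>\<not> y \<le> x\<close> by linarith
qed

lemma recip_diff_inj:
  fixes x y :: real
  assumes "0 < x" "0 < y" "1 / x - x = 1 / y - y"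
  shows "x = y"
  using recip_diff_le_imp_ge[of x y] recip_diff_le_imp_ge[of y x] assms by simp

text \<open>The sum up to n is \<open>1 / m n\<close>, for n = 0 because \<open>m 0 = 1\<close>;
  consecutive sums differ by \<open>m (Suc n)\<close>.\<close>

lemma partial_sum_recursion:
  fixes m :: "nat \<Rightarrow> real"
  assumes "m 0 = 1" "\<forall>n. m n > 0" "\<forall>n\<ge>1. (\<Sum>k\<le>n. m k) * m n = 1"
  shows "1 / m n = 1 / m (Suc n) - m (Suc n)"
proof -
  have S: "(\<Sum>k\<le>n. m k) = 1 / m n" for n
  proof (cases "n = 0")
    case False
    with assms(3) have "(\<Sum>k\<le>n. m k) * m n = 1" by simp
    moreover have "m n \<noteq> 0" using assms(2) by (simp add: less_imp_neq[symmetric])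
    ultimately show ?thesis by (simp add: nonzero_eq_divide_eq)
  qed (use assms in simp)
  show ?thesis using S[of n] S[of "Suc n"] by simp
qed

text \<open>The description operator needs existence and uniqueness. The partial sums of
  \<open>1 / inv_mseq k\<close> telescope to \<open>inv_mseq n\<close>; any other candidate agrees
  by induction, since 1/x - x is injective.\<close>

lemma mseq_props:
  "mseq 0 = 1 \<and> (\<forall>n. mseq n > 0) \<and> (\<forall>n\<ge>1. (\<Sum>k\<le>n. mseq k) * mseq n = 1)"
  unfolding mseq_def
proof (rule theI[where a = "\<lambda>n. 1 / inv_mseq n"])
  have sum: "(\<Sum>k\<le>n. 1 / inv_mseq k) = inv_mseq n" for n
  proof (induction n)
    case (Suc n)
    thus ?case by (simp add: inv_mseq_step[of n, symmetric])
  qed simp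
  have prod: "(\<Sum>k\<le>n. 1 / inv_mseq k) * (1 / inv_mseq n) = 1" for n
    using inv_mseq_pos[of n] unfolding sum by simp
  show "1 / inv_mseq 0 = 1 \<and> (\<forall>n. 1 / inv_mseq n > 0) \<and>
      (\<forall>n\<ge>1. (\<Sum>k\<le>n. 1 / inv_mseq k) * (1 / inv_mseq n) = 1)"
    by (intro conjI allI impI prod) (simp_all add: inv_mseq_pos)
next
  fix m :: "nat \<Rightarrow> real"
  assume m: "m 0 = 1 \<and> (\<forall>n. m n > 0) \<and> (\<forall>n\<ge>1. (\<Sum>k\<le>n. m k) * m n = 1)"
  hence m0: "m 0 = 1" and mpos: "\<And>n. m n > 0"
    and msum: "\<forall>n\<ge>1. (\<Sum>k\<le>n. m k) * m n = 1" by blast+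
  show "m = (\<lambda>n. 1 / inv_mseq n)"
  proof
    fix n show "m n = 1 / inv_mseq n"
    proof (induction n)
      case (Suc n)
      have "1 / m n = 1 / m (Suc n) - m (Suc n)"
        by (rule partial_sum_recursion[OF m0 _ msum]) (simp add: mpos)
      hence "inv_mseq n = 1 / m (Suc n) - m (Suc n)"
        unfolding Suc by simp
      hence "1 / m (Suc n) - m (Suc n) = 1 / (1 / inv_mseq (Suc n)) - 1 / inv_mseq (Suc n)"
        using inv_mseq_step[of n] by (simp only: divide_divide_eq_right)
      thus ?case by (rule recip_diff_inj[OF mpos, rotated]) (simp add: inv_mseq_pos)
    qed (simp add: m0)
  qed
qed

lemma mseq_0 [simp]: "mseq 0 = 1"
  using mseq_props by (rule conjunct1)

lemma mseq_pos [simp]: "mseq n > 0"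
  using mseq_props by (elim conjE allE)

lemma mseq_nonneg [simp]: "0 \<le> mseq n"
  and mseq_nonzero [simp]: "mseq n \<noteq> 0"
  using mseq_pos[of n] by linarith+

lemma mseq_step: "1 / mseq n = 1 / mseq (Suc n) - mseq (Suc n)"
proof (rule partial_sum_recursion)
  show "\<forall>n. mseq n > 0" by (intro allI mseq_pos)
  show "\<forall>n\<ge>1. (\<Sum>k\<le>n. mseq k) * mseq n = 1"
    using mseq_props by (elim conjE)
qed (rule mseq_0)

text \<open>In this form the ratios visibly exceed 1, and tend to 1 once the sequence is known to
  tend to 0.\<close>

lemma mseq_ratio: "mseq n / mseq (Suc n) = 1 + mseq n * mseq (Suc n)"
proof -
  have "mseq n > 0" "mseq (Suc n) > 0" by simp_all
  hence "mseq n / mseq (Suc n) = mseq n * (1 / mseq n + mseq (Suc n))"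
    unfolding mseq_step[of n] by simp
  thus ?thesis using \<open>mseq n > 0\<close> by (simp add: distrib_left)
qed

lemma mseq_Suc_less: "mseq (Suc n) < mseq n"
proof -
  have "mseq n / mseq (Suc n) > 1" by (simp add: mseq_ratio)
  thus ?thesis by simp
qed

text \<open>The sequence decreases and is positive, so it has a limit L; passing to the limit in the
  recursion gives L = L + L^3.\<close>

lemma mseq_tendsto_0: "mseq \<longlonglongrightarrow> 0"
proof -
  have dec: "decseq mseq" using mseq_Suc_less by (intro decseq_SucI) (simp add: less_imp_le)
  obtain L where L: "mseq \<longlonglongrightarrow> L"
    using decseq_convergent[OF dec, of 0] by (meson less_imp_le mseq_pos)
  have eq: "mseq n = mseq (Suc n) + mseq n * mseq (Suc n) * mseq (Suc n)" for n
  proof -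
    have "mseq (Suc n) \<noteq> 0" using mseq_pos[of "Suc n"] by linarith
    hence "mseq n = (1 + mseq n * mseq (Suc n)) * mseq (Suc n)"
      unfolding mseq_ratio[symmetric] by simp
    thus ?thesis by (simp only: distrib_right mult_1)
  qed
  have "(\<lambda>n. mseq (Suc n) + mseq n * mseq (Suc n) * mseq (Suc n)) \<longlonglongrightarrow> L + L * L * L"
    by (intro tendsto_intros LIMSEQ_Suc L)
  hence "mseq \<longlonglongrightarrow> L + L * L * L" using eq by simp
  hence "L = L + L * L * L" using L LIMSEQ_unique by blast
  thus ?thesis using L by simp
qed

section \<open>Uniqueness\<close>

lemma good_F_zero: "good_F F \<Longrightarrow> F 0 = 1"
  and good_F_pos: "good_F F \<Longrightarrow> s > -1 \<Longrightarrow> F s > 0"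
  and good_F_step: "good_F F \<Longrightarrow> s > -1 \<Longrightarrow> 1 / F s = 1 / F (s + 1) - F (s + 1)"
  and good_F_convex: "good_F F \<Longrightarrow> convex_on {-1<..} (\<lambda>s. ln (F s))"
  unfolding good_F_def by blast+

section \<open>Values of a solution at and between the integers\<close>

lemma good_F_nat:
  assumes "good_F F"
  shows "F (real n) = mseq n"
proof (induction n)
  case 0
  show ?case using good_F_zero[OF assms] by simp
next
  case (Suc n)
  have "1 / F (real (Suc n)) - F (real (Suc n)) = 1 / mseq (Suc n) - mseq (Suc n)"
    using good_F_step[OF assms, of "real n"] mseq_step[of n] Suc by (simp add: add.commute)
  thus ?case
    by (rule recip_diff_inj[rotated 2]) (simp_all add: good_F_pos[OF assms])
qed

text \<open>This transports agreement of two solutions by one unit in either direction.\<close>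

lemma good_F_eq_shift_iff:
  assumes F: "good_F F" and G: "good_F G" and s: "s > -1"
  shows "F (s + 1) = G (s + 1) \<longleftrightarrow> F s = G s"
proof
  assume "F (s + 1) = G (s + 1)"
  hence "1 / F s = 1 / G s"
    using good_F_step[OF F s] good_F_step[OF G s] by simp
  thus "F s = G s" by simp
next
  assume "F s = G s"
  hence "1 / F (s + 1) - F (s + 1) = 1 / G (s + 1) - G (s + 1)"
    using good_F_step[OF F s] good_F_step[OF G s] by simp
  thus "F (s + 1) = G (s + 1)"
    by (rule recip_diff_inj[rotated 2]) (use s in \<open>simp_all add: good_F_pos[OF F] good_F_pos[OF G]\<close>)
qed

text \<open>The chord of ln F from n to n+1 lies above its value at n+s.\<close>

lemma good_F_inverse_lower:
  assumes F: "good_F F" and s: "0 \<le> s" "s \<le> 1"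
  shows "(mseq n / mseq (Suc n)) powr s / mseq n \<le> 1 / F (real n + s)"
proof -
  have pos: "F (real n + s) > 0" "mseq n > 0" "mseq (Suc n) > 0"
    using good_F_pos[OF F] s by simp_all
  have "ln (F ((1 - s) * real n + s * real (Suc n))) \<le> (1 - s) * ln (F (real n)) + s * ln (F (real (Suc n)))"
    using s convex_onD[OF good_F_convex[OF F], of s "real n" "real (Suc n)"] by simp
  also have "(1 - s) * real n + s * real (Suc n) = real n + s" by (simp add: algebra_simps)
  finally have "ln (F (real n + s)) \<le> ln (mseq n) - s * (ln (mseq n) - ln (mseq (Suc n)))"
    unfolding good_F_nat[OF F] by (simp add: algebra_simps)
  also have "\<dots> = ln (mseq n / (mseq n / mseq (Suc n)) powr s)"
    using pos by (simp add: ln_div ln_powr)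
  finally have "F (real n + s) \<le> mseq n / (mseq n / mseq (Suc n)) powr s"
    using pos by (subst (asm) ln_le_cancel_iff) simp_all
  hence "1 / (mseq n / (mseq n / mseq (Suc n)) powr s) \<le> 1 / F (real n + s)"
    using pos by (intro divide_left_mono) simp_all
  thus ?thesis by simp
qed

text \<open>Here the known value at n+1 lies under the chord from n to n+1+s, which bounds the right
  endpoint from below.\<close>

lemma good_F_inverse_upper:
  assumes F: "good_F F" and s: "0 \<le> s"
  shows "1 / F (real (Suc n) + s) \<le> (mseq n / mseq (Suc n)) powr s / mseq (Suc n)"
proof -
  have pos: "F (real (Suc n) + s) > 0" "mseq n > 0" "mseq (Suc n) > 0"
    using good_F_pos[OF F] s by simp_all
  \<comment> \<open>The weight for which (1-t) n + t (n+1+s) = n+1. Multiplying by 1 + s = 1/t later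
    isolates ln F(n+1+s).\<close>
  define t where "t = 1 / (1 + s)"
  have t: "0 \<le> t" "t \<le> 1" "t * (1 + s) = 1" using s by (auto simp: t_def)
  have "ln (F ((1 - t) * real n + t * (real (Suc n) + s)))
      \<le> (1 - t) * ln (F (real n)) + t * ln (F (real (Suc n) + s))"
    using s t convex_onD[OF good_F_convex[OF F], of t "real n" "real (Suc n) + s"] by simp
  also have "(1 - t) * real n + t * (real (Suc n) + s) = real n + t * (1 + s)"
    by (simp add: algebra_simps)
  also have "\<dots> = real (Suc n)" using t by simp
  finally have "(1 + s) * ln (mseq (Suc n)) \<le>
      (1 + s) * ((1 - t) * ln (mseq n) + t * ln (F (real (Suc n) + s)))"
    unfolding good_F_nat[OF F] using s by (intro mult_left_mono) simp_all
  also have "\<dots> = (1 + s - t * (1 + s)) * ln (mseq n) + t * (1 + s) * ln (F (real (Suc n) + s))"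
    by (simp add: algebra_simps)
  also have "\<dots> = s * ln (mseq n) + ln (F (real (Suc n) + s))" using t by simp
  finally have "ln (mseq (Suc n)) - s * (ln (mseq n) - ln (mseq (Suc n))) \<le> ln (F (real (Suc n) + s))"
    by (simp add: algebra_simps)
  also have "ln (mseq (Suc n)) - s * (ln (mseq n) - ln (mseq (Suc n)))
      = ln (mseq (Suc n) / (mseq n / mseq (Suc n)) powr s)"
    using pos by (simp add: ln_div ln_powr)
  finally have "mseq (Suc n) / (mseq n / mseq (Suc n)) powr s \<le> F (real (Suc n) + s)"
    using pos by (subst (asm) ln_le_cancel_iff) simp_all
  hence "1 / F (real (Suc n) + s) \<le> 1 / (mseq (Suc n) / (mseq n / mseq (Suc n)) powr s)"
    using pos by (intro divide_left_mono) simp_all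
  thus ?thesis by simp
qed

lemma good_F_le_mseq:
  assumes F: "good_F F" and s: "0 \<le> s" "s \<le> 1"
  shows "F (real n + s) \<le> mseq n"
proof -
  have pos: "F (real n + s) > 0" "mseq n > 0"
    using good_F_pos[OF F] s by simp_all
  have "1 \<le> (mseq n / mseq (Suc n)) powr s"
    using s by (intro ge_one_powr_ge_zero) (simp_all add: mseq_ratio less_imp_le)
  hence "1 / mseq n \<le> (mseq n / mseq (Suc n)) powr s / mseq n"
    using pos by (intro divide_right_mono) simp_all
  also have "\<dots> \<le> 1 / F (real n + s)" by (rule good_F_inverse_lower[OF F s])
  finally show ?thesis using pos by (simp add: field_simps)
qed

section \<open>Comparison of two solutions\<close>

lemma powr_diff_le_diff:
  fixes a b s :: real
  assumes "1 \<le> b" "b \<le> a" "0 \<le> s" "s \<le> 1"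
  shows "a powr s - b powr s \<le> a - b"
proof -
  have le: "x powr s \<le> x" if "1 \<le> x" for x :: real
    using powr_mono[OF assms(4) that] that by simp
  \<comment> \<open>After this factorization, x^s <= x for x >= 1 bounds both factors.\<close>
  have "a powr s - b powr s = b powr s * ((a / b) powr s - 1)"
    using assms by (simp add: powr_divide right_diff_distrib)
  also have "\<dots> \<le> b * (a / b - 1)"
    using assms by (intro mult_mono le diff_right_mono) (auto intro!: ge_one_powr_ge_zero)
  also have "\<dots> = a - b" using assms by (simp add: right_diff_distrib)
  finally show ?thesis .
qed

text \<open>Both reciprocals lie between b^s / m_(n+1) and a^s / m_(n+1), where a and b are two
  consecutive ratios of the sequence.\<close>

lemma good_F_inverse_diff_le:
  assumes F: "good_F F" and G: "good_F G" and s: "0 \<le> s" "s \<le> 1"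
  shows "\<bar>1 / F (real (Suc n) + s) - 1 / G (real (Suc n) + s)\<bar> \<le> mseq n - mseq (Suc (Suc n))"
proof -
  define a where "a = mseq n / mseq (Suc n)"
  define b where "b = mseq (Suc n) / mseq (Suc (Suc n))"
  have a: "a = 1 + mseq n * mseq (Suc n)" and b: "b = 1 + mseq (Suc n) * mseq (Suc (Suc n))"
    by (simp_all add: a_def b_def mseq_ratio)
  have mono: "mseq (Suc (Suc n)) \<le> mseq n"
    using mseq_Suc_less[of n] mseq_Suc_less[of "Suc n"] by linarith
  have "b \<le> a" unfolding a b mult.commute[of "mseq n"]
    using mono by (intro add_left_mono mult_left_mono) (simp_all add: less_imp_le)
  have "1 \<le> b" by (simp add: b less_imp_le)
  have "\<bar>1 / F (real (Suc n) + s) - 1 / G (real (Suc n) + s)\<bar>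
      \<le> a powr s / mseq (Suc n) - b powr s / mseq (Suc n)"
    using good_F_inverse_lower[OF F s, of "Suc n"] good_F_inverse_upper[OF F s(1), of n]
      good_F_inverse_lower[OF G s, of "Suc n"] good_F_inverse_upper[OF G s(1), of n]
    unfolding a_def b_def by linarith
  also have "\<dots> = (a powr s - b powr s) / mseq (Suc n)" by (simp add: diff_divide_distrib)
  also have "\<dots> \<le> (a - b) / mseq (Suc n)"
    using powr_diff_le_diff[OF \<open>1 \<le> b\<close> \<open>b \<le> a\<close> s] by (intro divide_right_mono) (simp_all add: less_imp_le)
  also have "\<dots> = mseq n - mseq (Suc (Suc n))"
    by (simp add: a b mult.commute[of "mseq n"] right_diff_distrib[symmetric])
  finally show ?thesis .
qed

text \<open>With x and y the values at n+1+s, the functional equation multiplies the difference 1/x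
  - 1/y by 1 + x y, which is at most 1 + m_n m_(n+1) = m_n / m_(n+1).\<close>

lemma good_F_inverse_diff_mono:
  assumes F: "good_F F" and G: "good_F G" and s: "0 \<le> s" "s \<le> 1"
  shows "\<bar>1 / F (real n + s) - 1 / G (real n + s)\<bar> / mseq n
    \<le> \<bar>1 / F (real (Suc n) + s) - 1 / G (real (Suc n) + s)\<bar> / mseq (Suc n)"
proof -
  define x where "x = F (real (Suc n) + s)"
  define y where "y = G (real (Suc n) + s)"
  have pos: "x > 0" "y > 0" using good_F_pos[OF F] good_F_pos[OF G] s by (simp_all add: x_def y_def)
  have "real n + s > -1" using s by linarith
  moreover have "real n + s + 1 = real (Suc n) + s" by simp
  ultimately have "1 / F (real n + s) - 1 / G (real n + s) = (1 / x - x) - (1 / y - y)"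
    unfolding x_def y_def
    using good_F_step[OF F, of "real n + s"] good_F_step[OF G, of "real n + s"] by (simp only:)
  also have "\<dots> = (1 / x - 1 / y) * (1 + x * y)"
    using pos by (simp add: field_simps)
  finally have "\<bar>1 / F (real n + s) - 1 / G (real n + s)\<bar> = \<bar>1 / x - 1 / y\<bar> * (1 + x * y)"
    using pos by (simp add: abs_mult)
  also have "x * y \<le> mseq n * mseq (Suc n)"
    using good_F_le_mseq[OF F s, of "Suc n"] good_F_le_mseq[OF G s, of "Suc n"] mseq_Suc_less[of n] pos
    by (intro mult_mono) (auto simp: x_def y_def less_imp_le)
  hence "\<bar>1 / x - 1 / y\<bar> * (1 + x * y) \<le> \<bar>1 / x - 1 / y\<bar> * (mseq n / mseq (Suc n))"
    unfolding mseq_ratio by (intro mult_left_mono) simp_all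
  finally have "\<bar>1 / F (real n + s) - 1 / G (real n + s)\<bar> / mseq n
      \<le> \<bar>1 / x - 1 / y\<bar> * (mseq n / mseq (Suc n)) / mseq n"
    by (intro divide_right_mono) (simp_all add: less_imp_le)
  also have "\<dots> = \<bar>1 / x - 1 / y\<bar> / mseq (Suc n)" using mseq_pos[of n] by simp
  finally show ?thesis by (simp add: x_def y_def)
qed

lemma good_F_unique_unit_interval:
  assumes F: "good_F F" and G: "good_F G" and s: "0 \<le> s" "s \<le> 1"
  shows "F s = G s"
proof -
  define e where "e = (\<lambda>n. \<bar>1 / F (real n + s) - 1 / G (real n + s)\<bar> / mseq n)"
  have "incseq e"
  proof (rule incseq_SucI)
    show "e n \<le> e (Suc n)" for n
      unfolding e_def by (rule good_F_inverse_diff_mono[OF F G s])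
  qed
  have bound: "e (Suc n) \<le> 1 + mseq n * mseq (Suc n) - 1 / (1 + mseq (Suc n) * mseq (Suc (Suc n)))" for n
  proof -
    have "e (Suc n) \<le> (mseq n - mseq (Suc (Suc n))) / mseq (Suc n)"
      unfolding e_def using good_F_inverse_diff_le[OF F G s, of n]
      by (intro divide_right_mono) (simp_all add: less_imp_le)
    also have "\<dots> = mseq n / mseq (Suc n) - 1 / (mseq (Suc n) / mseq (Suc (Suc n)))"
      by (simp add: diff_divide_distrib)
    finally show ?thesis unfolding mseq_ratio .
  qed
  have "(\<lambda>n. 1 + mseq n * mseq (Suc n) - 1 / (1 + mseq (Suc n) * mseq (Suc (Suc n))))
      \<longlonglongrightarrow> 1 + 0 * 0 - 1 / (1 + 0 * 0)"
    by (intro tendsto_intros LIMSEQ_Suc mseq_tendsto_0) simp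
  moreover have "e 0 \<le> 1 + mseq n * mseq (Suc n) - 1 / (1 + mseq (Suc n) * mseq (Suc (Suc n)))" for n
    using incseqD[OF \<open>incseq e\<close>, of 0 "Suc n"] bound[of n] by simp
  ultimately have "e 0 \<le> 1 + 0 * 0 - 1 / (1 + 0 * 0)"
    by (intro LIMSEQ_le_const) auto
  thus ?thesis by (simp add: e_def)
qed

text \<open>Negative s is reached by one step down from the unit interval, other s by induction
  upwards from the fractional part.\<close>

lemma good_F_unique:
  assumes F: "good_F F" and G: "good_F G" and s: "s > -1"
  shows "F s = G s"
proof (cases "s \<ge> 0")
  case False
  with s have "F (s + 1) = G (s + 1)" by (intro good_F_unique_unit_interval[OF F G]) auto
  thus ?thesis using good_F_eq_shift_iff[OF F G s] by simp
next
  case True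
  have "F (frac s + real n) = G (frac s + real n)" for n
  proof (induction n)
    case 0
    show ?case
      using frac_lt_1[of s] by (intro good_F_unique_unit_interval[OF F G]) auto
  next
    case (Suc n)
    have "frac s + real n > -1" using frac_ge_0[of s] by linarith
    from good_F_eq_shift_iff[OF F G this] Suc show ?case by (simp add: add_ac)
  qed
  from this[of "nat \<lfloor>s\<rfloor>"] True show ?thesis by (simp add: frac_def)
qed

section \<open>An identity for measures with the given moments\<close>

lemma (in pair_sigma_finite) integrable_mult_pair:
  fixes f g :: "_ \<Rightarrow> real"
  assumes f: "integrable M1 f" and g: "integrable M2 g"
  shows "integrable (M1 \<Otimes>\<^sub>M M2) (\<lambda>(x, y). f x * g y)"
proof (rule Fubini_integrable)
  show "(\<lambda>(x, y). f x * g y) \<in> borel_measurable (M1 \<Otimes>\<^sub>M M2)"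
    using f g by (simp add: measurable_split_conv)
qed (use f g in \<open>simp_all add: abs_mult\<close>)

lemma (in pair_sigma_finite) integral_mult_pair:
  fixes f g :: "_ \<Rightarrow> real"
  assumes f: "integrable M1 f" and g: "integrable M2 g"
  shows "(\<integral>(x, y). f x * g y \<partial>(M1 \<Otimes>\<^sub>M M2)) = (\<integral>x. f x \<partial>M1) * (\<integral>y. g y \<partial>M2)"
proof -
  have "(\<integral>(x, y). f x * g y \<partial>(M1 \<Otimes>\<^sub>M M2)) = (\<integral>x. (\<integral>y. f x * g y \<partial>M2) \<partial>M1)"
    using integral_fst'[OF integrable_mult_pair[OF f g]] by simp
  thus ?thesis by simp
qed

text \<open>The measure lives on the whole line, so concentration on the unit interval is an
  almost-everywhere condition.\<close>

locale unit_interval_prob = prob_space M for M :: "real measure" +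
  assumes sets_eq [measurable_cong, simp]: "sets M = sets borel"
    and AE_unit: "AE t in M. t \<in> {0..1}"
begin

sublocale M2: pair_prob_space M M ..
sublocale M3: pair_prob_space M "M \<Otimes>\<^sub>M M" ..

abbreviation "M3 \<equiv> M \<Otimes>\<^sub>M (M \<Otimes>\<^sub>M M)"

lemma AE_unit_triple: "AE (t, u, v) in M3. t \<in> {0..1} \<and> u \<in> {0..1} \<and> v \<in> {0..1}"
proof -
  have 2: "AE (u, v) in M \<Otimes>\<^sub>M M. u \<in> {0..1} \<and> v \<in> {0..1}"
  proof (rule M2.AE_pair_measure)
    show "AE u in M. AE v in M. case (u, v) of (u, v) \<Rightarrow> u \<in> {0..1} \<and> v \<in> {0..1}"
      using AE_unit by eventually_elim (use AE_unit in \<open>simp\<close>)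
  qed measurable
  show ?thesis
  proof (rule M3.AE_pair_measure)
    show "AE t in M. AE p in M \<Otimes>\<^sub>M M. case (t, p) of (t, u, v) \<Rightarrow> t \<in> {0..1} \<and> u \<in> {0..1} \<and> v \<in> {0..1}"
      using AE_unit by eventually_elim (use 2 in \<open>simp\<close>)
  qed measurable
qed

lemma integrable_bounded_unit:
  fixes f :: "real \<Rightarrow> real"
  assumes [measurable]: "f \<in> borel_measurable borel" and "\<And>t. t \<in> {0..1} \<Longrightarrow> \<bar>f t\<bar> \<le> B"
  shows "integrable M f"
proof (rule integrable_const_bound[where B = B])
  show "AE t in M. norm (f t) \<le> B" using AE_unit by eventually_elim (simp add: assms)
qed measurable

lemma integral_triple_product:
  fixes f g h :: "real \<Rightarrow> real"
  assumes "integrable M f" "integrable M g" "integrable M h"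
  shows "integrable M3 (\<lambda>(t, u, v). f t * (g u * h v))"
    and "(\<integral>(t, u, v). f t * (g u * h v) \<partial>M3) = (\<integral>t. f t \<partial>M) * ((\<integral>t. g t \<partial>M) * (\<integral>t. h t \<partial>M))"
  using M3.integrable_mult_pair[OF assms(1) M2.integrable_mult_pair[OF assms(2,3)]]
    M3.integral_mult_pair[OF assms(1) M2.integrable_mult_pair[OF assms(2,3)]]
    M2.integral_mult_pair[OF assms(2,3)]
  by (simp_all add: case_prod_beta')

text \<open>Integrating \<^term>\<open>triple f\<close> is integrating \<^term>\<open>f\<close> against the multiplicative convolution of
  \<^term>\<open>M\<close> with two copies of the measure of density \<open>t\<close> with respect to \<^term>\<open>M\<close>.\<close>

definition triple :: "(real \<Rightarrow> real) \<Rightarrow> real \<times> real \<times> real \<Rightarrow> real" where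
  "triple f = (\<lambda>(t, u, v). u * v * f (t * u * v))"

text \<open>The equation alone does not assert integrability, since a Bochner integral defaults to
  0; integrability is tracked separately.\<close>

definition conv_invariant :: "(real \<Rightarrow> real) \<Rightarrow> bool" where
  "conv_invariant f \<longleftrightarrow> (\<integral>t. f t \<partial>M) = (\<integral>t. t * f t \<partial>M) + (\<integral>p. triple f p \<partial>M3)"

lemma measurable_triple [measurable]:
  assumes [measurable]: "f \<in> borel_measurable borel"
  shows "triple f \<in> borel_measurable M3"
  unfolding triple_def by measurable

lemma mult_unit: "t * u * v \<in> {0..1::real}" if "t \<in> {0..1}" "u \<in> {0..1}" "v \<in> {0..1}"
  using that by (auto intro!: mult_le_one)

text \<open>Dominated convergence in all three integrals: \<open>w\<close> also dominates
  \<open>t * g n t\<close> because t <= 1, and \<open>triple w\<close> dominates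
  \<open>triple (g n)\<close> because u v >= 0.\<close>

lemma conv_invariant_limit:
  assumes meas: "\<And>n. g n \<in> borel_measurable borel" "f \<in> borel_measurable borel"
    and bound: "\<And>n t. t \<in> {0..1} \<Longrightarrow> \<bar>g n t\<bar> \<le> w t"
    and w: "integrable M w" "integrable M3 (triple w)"
    and lim: "\<And>t. t \<in> {0..1} \<Longrightarrow> (\<lambda>n. g n t) \<longlonglongrightarrow> f t"
    and inv: "\<And>n. conv_invariant (g n)"
  shows "conv_invariant f"
proof -
  note [measurable] = meas
  have 1: "(\<lambda>n. \<integral>t. g n t \<partial>M) \<longlonglongrightarrow> (\<integral>t. f t \<partial>M)"
  proof (rule integral_dominated_convergence[where w = w])
    show "AE t in M. (\<lambda>n. g n t) \<longlonglongrightarrow> f t" using AE_unit by eventually_elim (rule lim)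
    show "AE t in M. norm (g n t) \<le> w t" for n using AE_unit by eventually_elim (simp add: bound)
  qed (use w in \<open>measurable\<close>)
  have 2: "(\<lambda>n. \<integral>t. t * g n t \<partial>M) \<longlonglongrightarrow> (\<integral>t. t * f t \<partial>M)"
  proof (rule integral_dominated_convergence[where w = w])
    show "AE t in M. (\<lambda>n. t * g n t) \<longlonglongrightarrow> t * f t"
      using AE_unit by eventually_elim (intro tendsto_intros lim)
    show "AE t in M. norm (t * g n t) \<le> w t" for n
      using AE_unit
    proof eventually_elim
      case (elim t)
      hence "\<bar>t\<bar> * \<bar>g n t\<bar> \<le> 1 * w t" by (intro mult_mono bound) auto
      thus ?case by (simp add: abs_mult)
    qed
  qed (use w in \<open>measurable\<close>)
  have 3: "(\<lambda>n. \<integral>p. triple (g n) p \<partial>M3) \<longlonglongrightarrow> (\<integral>p. triple f p \<partial>M3)"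
  proof (rule integral_dominated_convergence[where w = "triple w"])
    show "AE p in M3. (\<lambda>n. triple (g n) p) \<longlonglongrightarrow> triple f p"
      using AE_unit_triple
      by eventually_elim (auto simp: triple_def simp del: atLeastAtMost_iff intro!: tendsto_intros lim mult_unit)
    show "AE p in M3. norm (triple (g n) p) \<le> triple w p" for n
      using AE_unit_triple
      by eventually_elim (auto simp: triple_def abs_mult intro!: mult_left_mono bound mult_le_one)
  qed (use w in \<open>measurable\<close>)
  have "(\<lambda>n. \<integral>t. g n t \<partial>M) \<longlonglongrightarrow> (\<integral>t. t * f t \<partial>M) + (\<integral>p. triple f p \<partial>M3)"
    using tendsto_add[OF 2 3] inv unfolding conv_invariant_def by simp
  with 1 show ?thesis unfolding conv_invariant_def by (rule LIMSEQ_unique)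
qed

end

section \<open>From the moment recursion to continuous functions\<close>

locale mseq_measure = unit_interval_prob +
  assumes moments: "\<And>n. (\<integral>t. t ^ n \<partial>M) = mseq n"
begin

lemma integrable_power: "integrable M (\<lambda>t. t ^ n)"
  by (rule integrable_bounded_unit[where B = 1]) (auto intro: power_le_one)

lemma triple_power:
  shows "integrable M3 (triple (\<lambda>t. t ^ n))"
    and "(\<integral>p. triple (\<lambda>t. t ^ n) p \<partial>M3) = mseq n * (mseq (Suc n) * mseq (Suc n))"
proof -
  have "triple (\<lambda>t. t ^ n) = (\<lambda>(t, u, v). t ^ n * (u ^ Suc n * v ^ Suc n))"
    by (auto simp: triple_def power_mult_distrib fun_eq_iff)
  with integral_triple_product[OF integrable_power[of n] integrable_power[of "Suc n"] integrable_power[of "Suc n"]]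
  show "integrable M3 (triple (\<lambda>t. t ^ n))"
    and "(\<integral>p. triple (\<lambda>t. t ^ n) p \<partial>M3) = mseq n * (mseq (Suc n) * mseq (Suc n))"
    by (simp_all only: moments)
qed

text \<open>For monomials the claim reads m_n = m_(n+1) + m_n m_(n+1)^2.\<close>

lemma conv_invariant_power: "conv_invariant (\<lambda>t. t ^ n)"
proof -
  have "mseq n = (1 + mseq n * mseq (Suc n)) * mseq (Suc n)"
    unfolding mseq_ratio[symmetric] by simp
  moreover have "(\<integral>t. t * t ^ n \<partial>M) = mseq (Suc n)" using moments[of "Suc n"] by simp
  ultimately show ?thesis
    unfolding conv_invariant_def triple_power moments by (simp add: algebra_simps)
qed

lemma conv_invariant_polynomial: "conv_invariant (\<lambda>t. \<Sum>i\<le>n. a i * t ^ i)"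
proof -
  have [simp]: "integrable M (\<lambda>t. t * t ^ n)" for n
    using integrable_power[of "Suc n"] by simp
  have "triple (\<lambda>t. \<Sum>i\<le>n. a i * t ^ i) = (\<lambda>p. \<Sum>i\<le>n. a i * triple (\<lambda>t. t ^ i) p)"
    by (auto simp: triple_def fun_eq_iff sum_distrib_left algebra_simps)
  hence "(\<integral>p. triple (\<lambda>t. \<Sum>i\<le>n. a i * t ^ i) p \<partial>M3) = (\<Sum>i\<le>n. a i * (\<integral>p. triple (\<lambda>t. t ^ i) p \<partial>M3))"
    by (simp add: triple_power(1))
  moreover have "(\<integral>t. (\<Sum>i\<le>n. a i * t ^ i) \<partial>M) = (\<Sum>i\<le>n. a i * (\<integral>t. t ^ i \<partial>M))"
    by (simp add: integrable_power)
  moreover have "t * (\<Sum>i\<le>n. a i * t ^ i) = (\<Sum>i\<le>n. a i * (t * t ^ i))" for t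
    by (simp add: sum_distrib_left algebra_simps)
  hence "(\<integral>t. t * (\<Sum>i\<le>n. a i * t ^ i) \<partial>M) = (\<Sum>i\<le>n. a i * (\<integral>t. t * t ^ i \<partial>M))"
    by simp
  ultimately show ?thesis
    using conv_invariant_power unfolding conv_invariant_def
    by (simp add: sum.distrib distrib_left)
qed

lemma conv_invariant_continuous:
  assumes meas: "f \<in> borel_measurable borel" and cont: "continuous_on {0..1} f"
  shows "conv_invariant f"
proof -
  have "\<exists>g. (\<exists>a N. g = (\<lambda>t. \<Sum>i\<le>N. a i * t ^ i)) \<and> (\<forall>t\<in>{0..1}. \<bar>f t - g t\<bar> < 1 / Suc n)" for n :: nat
  proof -
    obtain g where "real_polynomial_function g" "\<And>t. t \<in> {0..1} \<Longrightarrow> \<bar>f t - g t\<bar> < 1 / Suc n"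
      using Stone_Weierstrass_real_polynomial_function[OF compact_Icc cont, of "1 / Suc n"] by auto
    thus ?thesis unfolding real_polynomial_function_iff_sum by blast
  qed
  then obtain g where poly: "\<And>n. \<exists>a N. g n = (\<lambda>t. \<Sum>i\<le>N. a i * t ^ i)"
    and close: "\<And>n t. t \<in> {0..1} \<Longrightarrow> \<bar>f t - g n t\<bar> < 1 / Suc n" by metis
  have "bounded (f ` {0..1})"
    using cont compact_Icc by (intro compact_imp_bounded compact_continuous_image)
  then obtain B where "\<forall>t\<in>{0..1}. \<bar>f t\<bar> \<le> B" by (auto simp: bounded_iff)
  hence B: "\<And>t. t \<in> {0..1} \<Longrightarrow> \<bar>f t\<bar> \<le> B" by blast
  have const: "triple (\<lambda>_. B + 1) = (\<lambda>(t, u, v). (B + 1) * (u * v))"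
    by (auto simp: triple_def)
  show ?thesis
  \<comment> \<open>The approximation errors are at most 1, so \<open>B + 1\<close> bounds all the
    polynomials on the unit interval.\<close>
  proof (rule conv_invariant_limit[where g = g and w = "\<lambda>_. B + 1"])
    show "g n \<in> borel_measurable borel" for n using poly[of n] by auto
    show "\<bar>g n t\<bar> \<le> B + 1" if "t \<in> {0..1}" for n t
    proof -
      have "1 / real (Suc n) \<le> 1" by simp
      thus ?thesis using close[OF that, of n] B[OF that] by linarith
    qed
    show "integrable M3 (triple (\<lambda>_. B + 1))"
      unfolding const using integrable_power[of 1] by (intro integral_triple_product) simp_all
    show "conv_invariant (g n)" for n using poly[of n] conv_invariant_polynomial by auto
    fix t :: real assume t: "t \<in> {0..1}"
    have "(\<lambda>n. f t - g n t) \<longlonglongrightarrow> 0"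
    proof (rule Lim_null_comparison)
      show "\<forall>\<^sub>F n in sequentially. norm (f t - g n t) \<le> 1 / Suc n"
        using close[OF t] by (auto intro!: always_eventually less_imp_le)
    qed (rule LIMSEQ_Suc[OF lim_1_over_n])
    thus "(\<lambda>n. g n t) \<longlonglongrightarrow> f t"
      using tendsto_diff[OF tendsto_const[of "f t"], of "\<lambda>n. f t - g n t"] by fastforce
  qed (use meas in simp_all)
qed

end

section \<open>The Mellin transform\<close>

context mseq_measure
begin

text \<open>Since \<open>0 powr s = 0\<close> for every s, including s = 0, mass at 0 never
  contributes: \<open>mellin 0\<close> is the mass of ]0,1].\<close>

definition mellin :: "real \<Rightarrow> real" where
  "mellin s = (\<integral>t. t powr s \<partial>M)"

lemma integrable_powr_nonneg: "s \<ge> 0 \<Longrightarrow> integrable M (\<lambda>t. t powr s)"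
  by (rule integrable_bounded_unit[where B = 1]) (auto intro: powr_le1)

lemma AE_triple_powr:
  "AE (t, u, v) in M3. u * v * (t * u * v) powr s = t powr s * (u powr (s + 1) * v powr (s + 1))"
  using AE_unit_triple
proof eventually_elim
  case (elim p)
  obtain t u v where p: "p = (t, u, v)" by (cases p) auto
  with elim have pos: "t \<ge> 0" "u \<ge> 0" "v \<ge> 0" by auto
  hence "u * v * (t * u * v) powr s = t powr s * ((u * u powr s) * (v * v powr s))"
    by (simp add: powr_mult mult_ac)
  thus ?case using pos by (simp only: p case_prod_conv powr_mult_base add.commute[of s])
qed

lemma triple_powr:
  assumes "integrable M (\<lambda>t. t powr s)" "integrable M (\<lambda>t. t powr (s + 1))"
  shows "integrable M3 (triple (\<lambda>t. t powr s))"
    and "(\<integral>p. triple (\<lambda>t. t powr s) p \<partial>M3) = mellin s * (mellin (s + 1) * mellin (s + 1))"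
proof -
  note prod = integral_triple_product[OF assms(1) assms(2) assms(2)]
  have AE: "AE p in M3. triple (\<lambda>t. t powr s) p = (case p of (t, u, v) \<Rightarrow> t powr s * (u powr (s + 1) * v powr (s + 1)))"
    using AE_triple_powr[of s] by eventually_elim (auto simp: triple_def)
  have meas: "(\<lambda>(t, u, v). t powr s * (u powr (s + 1) * v powr (s + 1))) \<in> borel_measurable M3"
    by measurable
  show "integrable M3 (triple (\<lambda>t. t powr s))"
    using prod(1) AE by (subst integrable_cong_AE[OF _ meas]) auto
  show "(\<integral>p. triple (\<lambda>t. t powr s) p \<partial>M3) = mellin s * (mellin (s + 1) * mellin (s + 1))"
    using prod(2) unfolding mellin_def by (subst integral_cong_AE[OF _ meas AE]) auto
qed

lemma conv_invariant_powr_iff: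
  assumes "integrable M (\<lambda>t. t powr s)" "integrable M (\<lambda>t. t powr (s + 1))"
  shows "conv_invariant (\<lambda>t. t powr s) \<longleftrightarrow> mellin s = mellin (s + 1) + mellin s * (mellin (s + 1))\<^sup>2"
proof -
  have "(\<integral>t. t * t powr s \<partial>M) = mellin (s + 1)"
    unfolding mellin_def
  proof (rule integral_cong_AE)
    show "AE t in M. t * t powr s = t powr (s + 1)"
      using AE_unit by eventually_elim (simp add: powr_mult_base add.commute)
  qed measurable
  thus ?thesis
    unfolding conv_invariant_def triple_powr[OF assms] by (simp add: mellin_def power2_eq_square)
qed

lemma mellin_1: "mellin 1 = mseq 1"
  unfolding mellin_def moments[of 1, symmetric]
proof (rule integral_cong_AE)
  show "AE t in M. t powr 1 = t ^ 1" using AE_unit by eventually_elim simp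
qed measurable

lemma mellin_nonneg: "mellin s \<ge> 0"
  unfolding mellin_def by (rule Bochner_Integration.integral_nonneg) simp

text \<open>Equality would force t = 1 almost everywhere, hence m_1 = 1 = m_0. Strictness makes the
  denominator 1 - F(s+1)^2 positive for s > -1.\<close>

lemma mellin_less_1:
  assumes "s > 0"
  shows "mellin s < 1"
proof -
  have int: "integrable M (\<lambda>t. t powr s)" using assms by (intro integrable_powr_nonneg) simp
  have nonneg: "AE t in M. 0 \<le> 1 - t powr s"
    using AE_unit by eventually_elim (use assms in \<open>auto intro: powr_le1\<close>)
  have diff: "(\<integral>t. 1 - t powr s \<partial>M) = 1 - mellin s"
    using int by (simp add: mellin_def prob_space)
  have "1 - mellin s \<noteq> 0"
  proof
    assume "1 - mellin s = 0"
    hence "AE t in M. 1 - t powr s = 0"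
      using diff int nonneg by (subst integral_nonneg_eq_0_iff_AE[symmetric]) auto
    with AE_unit have "AE t in M. t ^ 1 = 1"
    proof eventually_elim
      case (elim t)
      hence "t > 0" "t powr s = 1" by (auto intro: ccontr)
      hence "s * ln t = 0" by (simp add: powr_def split: if_splits)
      with assms \<open>t > 0\<close> show ?case by simp
    qed
    hence "(\<integral>t. t ^ 1 \<partial>M) = (\<integral>t. 1 \<partial>M)" by (intro integral_cong_AE) auto
    hence "mseq 1 = 1" by (simp only: moments) (simp add: prob_space)
    thus False using mseq_Suc_less[of 0] by simp
  qed
  moreover have "1 - mellin s \<ge> 0"
    using nonneg by (subst diff[symmetric]) (rule integral_nonneg_AE)
  ultimately show ?thesis by linarith
qed

end

text \<open>The factor \<^term>\<open>t\<close> makes the truncations vanish at \<open>0\<close>, as \<^term>\<open>0 powr s\<close> does.\<close>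

definition trunc_powr :: "real \<Rightarrow> nat \<Rightarrow> real \<Rightarrow> real" where
  "trunc_powr s n t = t * max t (1 / Suc n) powr (s - 1)"

section \<open>Estimates for the truncated powers\<close>

lemma max_inverse_Suc_pos: "max t (1 / real (Suc n)) > 0"
  by (rule less_le_trans[OF _ max.cobounded2]) simp

lemma trunc_powr_measurable [measurable]: "trunc_powr s n \<in> borel_measurable borel"
  unfolding trunc_powr_def by measurable

lemma continuous_on_trunc_powr: "continuous_on A (trunc_powr s n)"
proof -
  have "max t (1 / real (Suc n)) \<noteq> 0" for t :: real
    using max_inverse_Suc_pos[of t n] by linarith
  thus ?thesis
    unfolding trunc_powr_def by (intro continuous_intros) auto
qed

lemma trunc_powr_nonneg: "t \<ge> 0 \<Longrightarrow> trunc_powr s n t \<ge> 0"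
  by (simp add: trunc_powr_def)

lemma trunc_powr_le:
  assumes "t \<ge> 0" "s \<le> 1"
  shows "trunc_powr s n t \<le> t powr s"
proof (cases "t = 0")
  case False
  with assms have "max t (1 / Suc n) powr (s - 1) \<le> t powr (s - 1)"
    by (intro powr_mono2') auto
  hence "trunc_powr s n t \<le> t * t powr (s - 1)"
    unfolding trunc_powr_def using assms by (intro mult_left_mono)
  also have "\<dots> = t powr s" using False assms by (simp add: powr_diff)
  finally show ?thesis .
qed (simp add: trunc_powr_def)

lemma incseq_trunc_powr:
  assumes "t \<ge> 0" "s \<le> 1"
  shows "incseq (\<lambda>n. trunc_powr s n t)"
proof (rule incseq_SucI)
  fix n
  have "1 / real (Suc (Suc n)) \<le> 1 / real (Suc n)" by (intro divide_left_mono) auto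
  hence "max t (1 / real (Suc (Suc n))) \<le> max t (1 / real (Suc n))" by linarith
  hence "max t (1 / real (Suc n)) powr (s - 1) \<le> max t (1 / real (Suc (Suc n))) powr (s - 1)"
    using assms by (intro powr_mono2' max_inverse_Suc_pos) simp
  thus "trunc_powr s n t \<le> trunc_powr s (Suc n) t"
    unfolding trunc_powr_def using assms by (intro mult_left_mono)
qed

lemma trunc_powr_tendsto:
  assumes "t \<ge> 0"
  shows "(\<lambda>n. trunc_powr s n t) \<longlonglongrightarrow> t powr s"
proof (cases "t = 0")
  case False
  have "(\<lambda>n. max t (1 / Suc n)) \<longlonglongrightarrow> max t 0"
    by (intro tendsto_max tendsto_const LIMSEQ_Suc[OF lim_1_over_n])
  hence "(\<lambda>n. t * max t (1 / Suc n) powr (s - 1)) \<longlonglongrightarrow> t * t powr (s - 1)"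
    using assms False by (intro tendsto_intros) simp_all
  thus ?thesis using assms False by (simp add: trunc_powr_def powr_diff)
qed (simp add: trunc_powr_def)

text \<open>For c <= 1, scaling the maximum by c gives at most the maximum taken at t c; the
  exponent s - 1 <= 0 reverses this. With c = u v it separates the variables in
  \<open>triple\<close>.\<close>

lemma trunc_powr_mult_le:
  assumes "t \<ge> 0" "0 \<le> c" "c \<le> 1" "s \<le> 1"
  shows "trunc_powr s n (t * c) \<le> c powr s * trunc_powr s n t"
proof (cases "c = 0")
  case False
  let ?m = "max t (1 / Suc n)"
  have "c * (1 / Suc n) \<le> 1 / Suc n" using assms by (intro mult_left_le_one_le) simp_all
  hence "c * ?m \<le> max (t * c) (1 / Suc n)"
    using assms by (auto simp: max_def mult.commute intro: order_trans)
  hence "max (t * c) (1 / Suc n) powr (s - 1) \<le> (c * ?m) powr (s - 1)"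
    using assms False max_inverse_Suc_pos[of t n] by (intro powr_mono2') auto
  also have "\<dots> = c powr (s - 1) * ?m powr (s - 1)"
    using assms max_inverse_Suc_pos[of t n] by (intro powr_mult)
  finally have "trunc_powr s n (t * c) \<le> t * c * (c powr (s - 1) * ?m powr (s - 1))"
    unfolding trunc_powr_def using assms by (intro mult_left_mono) auto
  also have "\<dots> = c powr s * trunc_powr s n t"
    using assms False by (simp add: trunc_powr_def powr_diff)
  finally show ?thesis .
qed (simp add: trunc_powr_def)

context mseq_measure
begin

section \<open>Integrability and the functional equation\<close>

lemma conv_invariant_trunc_powr: "conv_invariant (trunc_powr s n)"
  by (intro conv_invariant_continuous continuous_on_trunc_powr) measurable

lemma integrable_trunc_powr: "integrable M (trunc_powr s n)"
proof -
  have "bounded (trunc_powr s n ` {0..1})"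
    by (intro compact_imp_bounded compact_continuous_image continuous_on_trunc_powr compact_Icc)
  then obtain B where "\<forall>t\<in>{0..1}. \<bar>trunc_powr s n t\<bar> \<le> B" by (auto simp: bounded_iff)
  thus ?thesis by (intro integrable_bounded_unit[where B = B]) auto
qed

text \<open>Invariance yields A <= q + A q^2 with q = F(s+1) < 1. The resulting bound is uniform in
  n.\<close>

lemma integral_trunc_powr_le:
  assumes s: "-1 < s" "s \<le> 1"
  shows "(\<integral>t. trunc_powr s n t \<partial>M) \<le> mellin (s + 1) / (1 - (mellin (s + 1))\<^sup>2)"
proof -
  let ?A = "\<integral>t. trunc_powr s n t \<partial>M" and ?q = "mellin (s + 1)"
  have int1: "integrable M (\<lambda>t. t powr (s + 1))" using s by (intro integrable_powr_nonneg) simp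
  have "(\<integral>t. t * trunc_powr s n t \<partial>M) \<le> ?q"
    unfolding mellin_def
  proof (rule integral_mono_AE'[OF int1])
    show "AE t in M. t * trunc_powr s n t \<le> t powr (s + 1)"
      using AE_unit
    proof eventually_elim
      case (elim t)
      hence "t * trunc_powr s n t \<le> t * t powr s"
        using s by (intro mult_left_mono trunc_powr_le) auto
      also have "\<dots> = t powr (s + 1)" using elim by (simp add: powr_mult_base add.commute)
      finally show ?case .
    qed
    show "AE t in M. 0 \<le> t powr (s + 1)" by simp
  qed
  moreover have "(\<integral>p. triple (trunc_powr s n) p \<partial>M3) \<le> ?A * (?q * ?q)"
    unfolding mellin_def integral_triple_product(2)[OF integrable_trunc_powr int1 int1, symmetric]
  proof (rule integral_mono_AE')
    show "AE p in M3. triple (trunc_powr s n) p \<le> (case p of (t, u, v) \<Rightarrow> trunc_powr s n t * (u powr (s + 1) * v powr (s + 1)))"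
      using AE_unit_triple
    proof eventually_elim
      case (elim p)
      obtain t u v where p: "p = (t, u, v)" by (cases p) auto
      with elim have unit: "t \<ge> 0" "u \<ge> 0" "v \<ge> 0" "u \<le> 1" "v \<le> 1" by auto
      have "u * v * trunc_powr s n (t * (u * v)) \<le> u * v * ((u * v) powr s * trunc_powr s n t)"
        using unit s by (intro mult_left_mono trunc_powr_mult_le) (auto intro: mult_le_one)
      also have "\<dots> = trunc_powr s n t * ((u * u powr s) * (v * v powr s))"
        using unit by (simp add: powr_mult mult_ac)
      also have "\<dots> = trunc_powr s n t * (u powr (s + 1) * v powr (s + 1))"
        using unit by (simp only: powr_mult_base add.commute[of s])
      finally show ?case by (simp add: p triple_def mult.assoc)
    qed
    show "AE p in M3. 0 \<le> (case p of (t, u, v) \<Rightarrow> trunc_powr s n t * (u powr (s + 1) * v powr (s + 1)))"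
      using AE_unit_triple by eventually_elim (auto intro!: mult_nonneg_nonneg trunc_powr_nonneg)
  qed (rule integral_triple_product[OF integrable_trunc_powr int1 int1])
  ultimately have "?A \<le> ?q + ?A * (?q * ?q)"
    using conv_invariant_trunc_powr[of s n] unfolding conv_invariant_def by linarith
  hence "?A * (1 - ?q\<^sup>2) \<le> ?q" by (simp add: algebra_simps power2_eq_square)
  moreover have "?q\<^sup>2 < 1"
    using mellin_less_1[of "s + 1"] mellin_nonneg[of "s + 1"] s by (simp add: power_less_one_iff)
  ultimately show ?thesis by (simp add: pos_le_divide_eq)
qed

text \<open>For negative s, monotone convergence applies to the truncations, whose integrals are
  bounded.\<close>

lemma integrable_powr:
  assumes "s > -1"
  shows "integrable M (\<lambda>t. t powr s)"
proof (cases "s \<ge> 0")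
  case False
  with assms have s: "-1 < s" "s \<le> 1" by auto
  let ?A = "\<lambda>n. \<integral>t. trunc_powr s n t \<partial>M"
  have mono: "AE t in M. mono (\<lambda>n. trunc_powr s n t)"
    using AE_unit by eventually_elim (use s in \<open>auto intro!: incseq_trunc_powr\<close>)
  have "incseq ?A"
  proof (rule incseq_SucI)
    fix n
    show "?A n \<le> ?A (Suc n)"
      using mono by (intro integral_mono_AE integrable_trunc_powr) (auto simp: mono_def)
  qed
  from incseq_convergent[OF this, of "mellin (s + 1) / (1 - (mellin (s + 1))\<^sup>2)"]
  obtain L where L: "?A \<longlonglongrightarrow> L" using integral_trunc_powr_le[OF s] by blast
  show ?thesis
  proof (rule integrable_monotone_convergence[OF integrable_trunc_powr mono _ L])
    show "AE t in M. (\<lambda>n. trunc_powr s n t) \<longlonglongrightarrow> t powr s"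
      using AE_unit by eventually_elim (auto intro!: trunc_powr_tendsto)
  qed measurable
qed (rule integrable_powr_nonneg)

lemma mellin_shift:
  assumes "s > -1"
  shows "mellin s = mellin (s + 1) + mellin s * (mellin (s + 1))\<^sup>2"
proof -
  have int: "integrable M (\<lambda>t. t powr s)" "integrable M (\<lambda>t. t powr (s + 1))"
    using assms by (simp_all add: integrable_powr)
  have "conv_invariant (\<lambda>t. t powr s)"
  proof (cases "s > 0")
    case True
    thus ?thesis
      by (intro conv_invariant_continuous continuous_on_powr') (auto intro: continuous_intros)
  next
    \<comment> \<open>For s <= 0 the power is discontinuous at 0, even at s = 0, so it is approached
      by truncations with the power itself as dominating function.\<close>
    case False
    show ?thesis
    proof (rule conv_invariant_limit[OF _ _ _ int(1) triple_powr(1)[OF int]])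
      show "trunc_powr s n \<in> borel_measurable borel" for n by measurable
      show "\<bar>trunc_powr s n t\<bar> \<le> t powr s" if "t \<in> {0..1}" for n t
        using that False by (simp add: trunc_powr_nonneg trunc_powr_le)
    qed (auto intro: trunc_powr_tendsto conv_invariant_trunc_powr)
  qed
  thus ?thesis using conv_invariant_powr_iff[OF int] by simp
qed

text \<open>The shift equation at 0 is linear in \<open>mellin 0\<close>, with solution 1 and
  nonzero coefficient 1 - m_1^2 = m_1.\<close>

lemma mellin_0: "mellin 0 = 1"
proof -
  have "1 / mseq 0 = 1 / mseq 1 - mseq 1" using mseq_step[of 0] by simp
  hence m: "mseq 1 = 1 - (mseq 1)\<^sup>2" by (simp add: field_simps power2_eq_square)
  have "mellin 0 = mseq 1 + mellin 0 * (mseq 1)\<^sup>2"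
    using mellin_shift[of 0] by (simp add: mellin_1)
  with m have "(mellin 0 - 1) * (1 - (mseq 1)\<^sup>2) = 0" by algebra
  with m show ?thesis by (metis mseq_nonzero mult_eq_0_iff right_minus_eq)
qed

lemma mellin_pos:
  assumes "s > -1"
  shows "mellin s > 0"
proof -
  \<comment> \<open>Any n >= s gives t^n <= t^s on ]0,1]; the successor ensures n > 0, so that both
    sides vanish at t = 0.\<close>
  define n where "n = Suc (nat \<lceil>s\<rceil>)"
  have "s \<le> real n" "n > 0" unfolding n_def by linarith+
  have "mseq n \<le> mellin s"
    unfolding mellin_def moments[symmetric]
  proof (rule integral_mono_AE[OF integrable_power integrable_powr[OF assms]])
    show "AE t in M. t ^ n \<le> t powr s"
      using AE_unit
    proof eventually_elim
      case (elim t)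
      show ?case
      proof (cases "t = 0")
        case False
        with elim have "t powr real n \<le> t powr s"
          using \<open>s \<le> real n\<close> by (intro powr_mono') auto
        with False elim show ?thesis by (simp add: powr_realpow)
      qed (use \<open>n > 0\<close> in \<open>simp add: zero_power\<close>)
    qed
  qed
  thus ?thesis using mseq_pos[of n] by linarith
qed

text \<open>This is Hoelder's inequality, obtained by integrating Young's inequality for the
  normalized powers.\<close>

lemma mellin_log_convex: "convex_on {-1<..} (\<lambda>s. ln (mellin s))"
proof (rule convex_onI)
  fix a x y :: real
  assume a: "0 < a" "a < 1" and xy: "x \<in> {-1<..}" "y \<in> {-1<..}"
  let ?z = "(1 - a) * x + a * y"
  have "?z \<in> {-1<..}"
    using convexD[OF convex_real_interval(3) xy, of "1 - a" a] a by simp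
  hence z: "?z > -1" by simp
  have pos: "mellin x > 0" "mellin y > 0" "mellin ?z > 0" using xy z by (auto intro!: mellin_pos)
  have int: "integrable M (\<lambda>t. t powr x)" "integrable M (\<lambda>t. t powr y)"
    using xy by (auto intro!: integrable_powr)
  \<comment> \<open>The target bound for \<open>mellin ?z\<close>; dividing by it normalizes both
    powers to integral 1.\<close>
  define K where "K = mellin x powr (1 - a) * mellin y powr a"
  have "K > 0" using pos by (simp add: K_def)
  have "mellin ?z / K = (\<integral>t. t powr ?z / K \<partial>M)" by (simp add: mellin_def)
  also have "\<dots> \<le> (\<integral>t. (1 - a) * (t powr x / mellin x) + a * (t powr y / mellin y) \<partial>M)"
  proof (rule integral_mono_AE)
    show "AE t in M. t powr ?z / K \<le> (1 - a) * (t powr x / mellin x) + a * (t powr y / mellin y)"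
      using AE_unit
    proof eventually_elim
      case (elim t)
      show ?case
      proof (cases "t = 0")
        case False
        with elim have t: "t > 0" by simp
        have "t powr ?z / K = (t powr x / mellin x) powr (1 - a) * (t powr y / mellin y) powr a"
          using t pos by (simp add: K_def powr_divide powr_powr powr_add mult.commute)
        also have "\<dots> \<le> (1 - a) * (t powr x / mellin x) + a * (t powr y / mellin y)"
          using a t pos by (intro Youngs_inequality_0) auto
        finally show ?thesis .
      qed simp
    qed
  qed (use int integrable_powr[OF z] in auto)
  also have "\<dots> = (1 - a) * (mellin x / mellin x) + a * (mellin y / mellin y)"
    using int by (simp add: mellin_def)
  also have "\<dots> = 1" using pos by simp
  finally have "mellin ?z \<le> K" using \<open>K > 0\<close> by (simp add: pos_divide_le_eq)
  hence "ln (mellin ?z) \<le> ln K" using pos by (intro ln_mono)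
  also have "ln K = (1 - a) * ln (mellin x) + a * ln (mellin y)"
    using pos by (simp add: K_def ln_mult ln_powr)
  finally show "ln (mellin ((1 - a) *\<^sub>R x + a *\<^sub>R y)) \<le> (1 - a) * ln (mellin x) + a * ln (mellin y)"
    by simp
qed simp

lemma good_F_mellin: "good_F mellin"
  unfolding good_F_def
proof (intro conjI allI impI)
  fix s :: real assume s: "s > -1"
  show "mellin s > 0" using s by (rule mellin_pos)
  define p q where "p = mellin s" and "q = mellin (s + 1)"
  have "p > 0" "q > 0" using s by (auto simp: p_def q_def intro!: mellin_pos)
  moreover have "p = q + p * q\<^sup>2" unfolding p_def q_def by (rule mellin_shift[OF s])
  hence "q = p * (1 - q * q)" by (simp add: algebra_simps power2_eq_square)
  hence "1 / p = (1 - q * q) / q" using \<open>p > 0\<close> \<open>q > 0\<close>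
    by (simp add: frac_eq_eq mult.commute)
  ultimately show "1 / mellin s = 1 / mellin (s + 1) - mellin (s + 1)"
    unfolding p_def[symmetric] q_def[symmetric] by (simp add: diff_divide_distrib)
qed (rule mellin_0 mellin_log_convex)+

end

theorem theorem1p3:
  fixes \<mu> :: "real measure"
  assumes sets_mu: "sets \<mu> = sets borel"
    and prob: "prob_space \<mu>"
    and supp: "\<mu> {0..1} = 1"
    and moments: "\<And>n. (\<integral>t. t ^ n \<partial>\<mu>) = mseq n"
  shows "(\<forall>s>-1. integrable \<mu> (\<lambda>t. t powr s))
         \<and> good_F (\<lambda>s. \<integral>t. t powr s \<partial>\<mu>)
         \<and> (\<forall>G. good_F G \<longrightarrow> (\<forall>s>-1. G s = (\<integral>t. t powr s \<partial>\<mu>)))"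
proof -
  interpret prob_space \<mu> by (rule prob)
  have "AE t in \<mu>. t \<in> {0..1}"
    using supp sets_mu by (subst AE_in_set_eq_1) (auto simp: measure_def)
  then interpret mseq_measure \<mu>
    by unfold_locales (use sets_mu moments in auto)
  have good: "good_F (\<lambda>s. \<integral>t. t powr s \<partial>\<mu>)"
    using good_F_mellin unfolding mellin_def[abs_def] .
  show ?thesis
    by (intro conjI allI impI good integrable_powr good_F_unique[OF _ good])
qed

end
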